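(* Let $R$ be an arbitrary unital associative and commutative ring and let $A$ be a unital associative $R$-algebra generated by a set $X$. Let $U$ be a two-sided ideal in $A$ generated by a set $S$ and let $W$ be the two-sided ideal in $A$ generated by the set \[ \bigl\{ [u, a_1, a_2] \mid u \in U, \ a_1, a_2 \in A \bigr\} . \] Then $W$ is generated (as a two-sided ideal in $A$) by the following elements, where $s$ ranges over $S$ and all $x_i$ range over $X$: \[ [s, x_1, x_2], \] \[ s [x_1, x_2, x_3], \] \[ [s, x_1] [x_2, x_3, x_4], \] \[ [s, x_1] [x_2, x_3] + [s, x_2] [x_1, x_3], \] \[ s \bigl( [x_1, x_2] [x_3, x_4] + [x_1, x_3] [x_2, x_4] \bigr). \]
   Context: Commutators are additive and left-normed: $[a_1,a_2] = a_1a_2 - a_2a_1$ and $[a_1,a_2,a_3] = \bigl[[a_1,a_2],a_3\bigr]$. "Generated by $X$" means generated as a unital $R$-algebra. *)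

theory Defs
  imports "HOL-Algebra.Module" "HOL-Algebra.Ideal" "HOL-Algebra.Subrings"
begin

text \<open>
  The library locale \<^locale>\<open>algebra\<close> demands a commutative multiplication on the module; the
  following is its analogue for an arbitrary unital associative ring.  Commutativity being absent,
  scalars must be movable past both factors of a product.
\<close>

locale assoc_algebra = module R A + ring A for R and A (structure) +
  assumes smult_mult_left:
      "\<lbrakk> r \<in> carrier R; x \<in> carrier A; y \<in> carrier A \<rbrakk>
        \<Longrightarrow> (r \<odot>\<^bsub>A\<^esub> x) \<otimes>\<^bsub>A\<^esub> y = r \<odot>\<^bsub>A\<^esub> (x \<otimes>\<^bsub>A\<^esub> y)"
    and smult_mult_right:
      "\<lbrakk> r \<in> carrier R; x \<in> carrier A; y \<in> carrier A \<rbrakk>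
        \<Longrightarrow> x \<otimes>\<^bsub>A\<^esub> (r \<odot>\<^bsub>A\<^esub> y) = r \<odot>\<^bsub>A\<^esub> (x \<otimes>\<^bsub>A\<^esub> y)"

locale unital_subalgebra = subring B A + submodule B R A for B and R and A (structure)

definition generated_algebra ::
    "('r, 'n) ring_scheme \<Rightarrow> ('r, 'a, 'm) module_scheme \<Rightarrow> 'a set \<Rightarrow> 'a set"
  where "generated_algebra R A X = \<Inter>{B. unital_subalgebra B R A \<and> X \<subseteq> B}"

definition commutator :: "('a, 'm) ring_scheme \<Rightarrow> 'a \<Rightarrow> 'a \<Rightarrow> 'a"
  where "commutator A a b = a \<otimes>\<^bsub>A\<^esub> b \<ominus>\<^bsub>A\<^esub> b \<otimes>\<^bsub>A\<^esub> a"

definition commutator3 :: "('a, 'm) ring_scheme \<Rightarrow> 'a \<Rightarrow> 'a \<Rightarrow> 'a \<Rightarrow> 'a"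
  where "commutator3 A a b c = commutator A (commutator A a b) c"

end

theory Submission
  imports Defs "HOL-Algebra.Generated_Rings"
begin

text \<open>
  Write \<open>\<langle>a, b\<rangle>\<close> and \<open>\<langle>a, b, c\<rangle>\<close> for commutators and \<open>skew a b c d\<close> for
  \<open>\<langle>a, b\<rangle> \<langle>c, d\<rangle> + \<langle>a, c\<rangle> \<langle>b, d\<rangle>\<close>, so that the five families of generators read
  \<open>\<langle>s, x, y\<rangle>\<close>, \<open>s \<langle>x, y, z\<rangle>\<close>, \<open>\<langle>s, x\<rangle> \<langle>y, z, w\<rangle>\<close>, \<open>skew s x y z\<close> and \<open>s (skew x y z w)\<close>.

  For an ideal \<open>I\<close>, let \<open>tame\<close> be the set of all \<open>u\<close> such that \<open>I\<close> contains \<open>\<langle>u, a, b\<rangle>\<close>,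
  \<open>skew u a b c\<close>, \<open>u p \<langle>a, b, c\<rangle>\<close> and \<open>u p (skew a b c d)\<close> for all ring elements \<open>a, b, c, d, p\<close>.
  The conditions on \<open>u\<close> are those that expanding \<open>\<langle>u q, a, b\<rangle>\<close> by the Leibniz rule makes necessary,
  and they are self-reproducing: \<open>tame\<close> is an ideal (\<open>ideal_tame\<close>).  Conversely every ideal \<open>U\<close> with
  \<open>\<langle>U, A, A\<rangle> \<subseteq> I\<close> lies in \<open>tame\<close> (\<open>subset_tame\<close>).  So \<open>tame\<close> is the largest ideal whose double
  commutators lie in \<open>I\<close>, and membership can be tested on ideal generators.

  Taking \<open>I = W\<close> gives \<open>S \<subseteq> U \<subseteq> tame\<close>, whence all five families lie in \<open>W\<close>.  Taking for \<open>I\<close> the ideal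
  generated by the five families, it suffices to show \<open>S \<subseteq> tame\<close> (\<open>mem_tame\<close>), that is, to pass from
  generators \<open>x \<in> X\<close> to arbitrary ring elements in the conditions on \<open>s \<in> S\<close>.  Two mechanisms do this.
  First, for a fixed \<open>t\<close>, the conditions \<open>\<langle>t, x, y\<rangle>, skew t x y z, \<langle>t, x\<rangle> \<langle>y, z, w\<rangle> \<in> I\<close> on generators
  imply \<open>\<langle>t, a, b\<rangle>, skew t a b c \<in> I\<close> for all elements (\<open>entries_extend\<close>).  Applied to \<open>t = s\<close> this
  settles the conditions without a factor \<open>p\<close>.  Secondly, the set of all \<open>z\<close> with \<open>s A z \<subseteq> I\<close> is an
  ideal \<open>J\<close>.  It contains \<open>\<langle>x, y, z\<rangle>\<close> and \<open>skew x y z w\<close> on generators (\<open>bracket_annihilates\<close>), and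
  two further applications of \<open>entries_extend\<close>, to the ideal \<open>J\<close>, show that it contains these expressions for
  arbitrary entries (\<open>all_entries_extend\<close>).

  Scalars are treated as additional ring generators.  They are central, so every expression above
  vanishes when a generator in it is replaced by a scalar, and the argument takes place in a plain
  ring.
\<close>

text \<open>
  The obstruction to \<open>\<langle>a, b\<rangle> \<langle>c, d\<rangle>\<close> changing sign when \<open>b\<close> and \<open>c\<close> are exchanged.
\<close>

definition skew_defect :: "('a, 'm) ring_scheme \<Rightarrow> 'a \<Rightarrow> 'a \<Rightarrow> 'a \<Rightarrow> 'a \<Rightarrow> 'a"
  where "skew_defect A a b c d =
    commutator A a b \<otimes>\<^bsub>A\<^esub> commutator A c d \<oplus>\<^bsub>A\<^esub> commutator A a c \<otimes>\<^bsub>A\<^esub> commutator A b d"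

section \<open>Commutator identities\<close>

context ring
begin

abbreviation bracket ("\<langle>_, _\<rangle>")
  where "\<langle>a, b\<rangle> \<equiv> commutator R a b"

abbreviation bracket3 ("\<langle>_, _, _\<rangle>")
  where "\<langle>a, b, c\<rangle> \<equiv> commutator3 R a b c"

abbreviation skew :: "'a \<Rightarrow> 'a \<Rightarrow> 'a \<Rightarrow> 'a \<Rightarrow> 'a"
  where "skew \<equiv> skew_defect R"

text \<open>
  These rules bring an equation of noncommutative polynomials to the form \<open>P = Q\<close> with \<open>P\<close> and \<open>Q\<close>
  sums of monomials with positive sign: differences are moved outwards and then to the other side of
  the equation.  Sorting the summands then decides the equation; opposite monomials on the same side
  never have to be brought together and cancelled.
\<close>

lemma diff_rules:
  assumes "a \<in> carrier R" "b \<in> carrier R" "c \<in> carrier R"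
  shows "a \<oplus> (b \<ominus> c) = (a \<oplus> b) \<ominus> c"
    and "(a \<ominus> b) \<oplus> c = (a \<oplus> c) \<ominus> b"
    and "(a \<ominus> b) \<ominus> c = a \<ominus> (b \<oplus> c)"
    and "a \<ominus> (b \<ominus> c) = (a \<oplus> c) \<ominus> b"
    and "a \<otimes> (b \<ominus> c) = a \<otimes> b \<ominus> a \<otimes> c"
    and "(b \<ominus> c) \<otimes> a = b \<otimes> a \<ominus> c \<otimes> a"
  using assms by algebra+

lemma diff_eq_iff:
  assumes "a \<in> carrier R" "b \<in> carrier R" "c \<in> carrier R"
  shows "a \<ominus> b = c \<longleftrightarrow> a = c \<oplus> b" and "c = a \<ominus> b \<longleftrightarrow> c \<oplus> b = a"
  using assms by (metis a_comm add.m_closed add.inv_solve_right' a_minus_def)+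

lemma minus_eq_zero_diff: "a \<in> carrier R \<Longrightarrow> \<ominus> a = \<zero> \<ominus> a"
  by algebra

lemmas normalize = diff_rules diff_eq_iff minus_eq_zero_diff l_distr r_distr m_assoc a_ac

lemmas expand = commutator3_def commutator_def skew_defect_def normalize

lemma bracket_closed [simp]:
  "\<lbrakk>a \<in> carrier R; b \<in> carrier R\<rbrakk> \<Longrightarrow> \<langle>a, b\<rangle> \<in> carrier R"
  "\<lbrakk>a \<in> carrier R; b \<in> carrier R; c \<in> carrier R\<rbrakk> \<Longrightarrow> \<langle>a, b, c\<rangle> \<in> carrier R"
  "\<lbrakk>a \<in> carrier R; b \<in> carrier R; c \<in> carrier R; d \<in> carrier R\<rbrakk> \<Longrightarrow> skew a b c d \<in> carrier R"
  by (simp_all add: commutator_def commutator3_def skew_defect_def)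

lemma bracket_linear:
  assumes "a \<in> carrier R" "b \<in> carrier R" "c \<in> carrier R"
  shows "\<langle>a \<oplus> b, c\<rangle> = \<langle>a, c\<rangle> \<oplus> \<langle>b, c\<rangle>" "\<langle>c, a \<oplus> b\<rangle> = \<langle>c, a\<rangle> \<oplus> \<langle>c, b\<rangle>"
    and "\<langle>\<ominus> a, c\<rangle> = \<ominus> \<langle>a, c\<rangle>" "\<langle>c, \<ominus> a\<rangle> = \<ominus> \<langle>c, a\<rangle>"
  using assms by (simp_all add: expand)

lemma bracket_trivial:
  assumes "a \<in> carrier R"
  shows "\<langle>\<zero>, a\<rangle> = \<zero>" "\<langle>a, \<zero>\<rangle> = \<zero>" "\<langle>\<one>, a\<rangle> = \<zero>" "\<langle>a, \<one>\<rangle> = \<zero>"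
  using assms by (simp_all add: expand)

lemma jacobi:
  assumes "t \<in> carrier R" "a \<in> carrier R" "b \<in> carrier R"
  shows "\<langle>t, \<langle>a, b\<rangle>\<rangle> = \<langle>t, a, b\<rangle> \<ominus> \<langle>t, b, a\<rangle>"
  using assms by (simp add: expand)

text \<open>
  The Leibniz rule applied twice yields mixed terms \<open>\<langle>u, b\<rangle> \<langle>q, c\<rangle> + \<langle>u, c\<rangle> \<langle>q, b\<rangle>\<close>, which are the
  negative of a skew defect.
\<close>

lemma bracket3_mult:
  assumes "u \<in> carrier R" "q \<in> carrier R" "b \<in> carrier R" "c \<in> carrier R"
  shows "\<langle>u \<otimes> q, b, c\<rangle> = \<langle>u, b, c\<rangle> \<otimes> q \<ominus> skew u b c q \<oplus> u \<otimes> \<langle>q, b, c\<rangle>"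
  using assms by (simp add: expand)

lemma skew_mult_first:
  assumes "u \<in> carrier R" "q \<in> carrier R" "a \<in> carrier R" "b \<in> carrier R" "c \<in> carrier R"
  shows "skew (u \<otimes> q) a b c = u \<otimes> skew q a b c \<oplus> q \<otimes> skew u a b c
    \<oplus> \<langle>u, a, q\<rangle> \<otimes> \<langle>b, c\<rangle> \<oplus> \<langle>u, b, q\<rangle> \<otimes> \<langle>a, c\<rangle>"
  using assms by (simp add: expand)

text \<open>
  The last summand measures the failure of \<open>a\<close> to commute with \<open>\<langle>b, c\<rangle>\<close>; it is the obstacle in
  every induction on the entries of \<open>skew\<close>.
\<close>

lemma skew_mult_third:
  assumes "t \<in> carrier R" "b \<in> carrier R" "z \<in> carrier R" "a \<in> carrier R" "c \<in> carrier R"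
  shows "skew t b (z \<otimes> a) c = z \<otimes> skew t b a c \<oplus> skew t b z c \<otimes> a
    \<oplus> \<langle>t, b, z\<rangle> \<otimes> \<langle>a, c\<rangle> \<oplus> \<langle>t, z\<rangle> \<otimes> \<langle>a, \<langle>b, c\<rangle>\<rangle>"
  using assms by (simp add: expand)

text \<open>
  Here \<open>\<langle>t, q\<rangle> \<langle>w, d\<rangle>\<close> with \<open>w = \<langle>a, b\<rangle>\<close> is exchanged for \<open>\<langle>t, w\<rangle> \<langle>q, d\<rangle>\<close> up to a skew defect, and
  \<open>\<langle>t, w\<rangle>\<close> is a difference of double commutators of \<open>t\<close> by the Jacobi identity.  Hence \<open>\<langle>t, q\<rangle>\<close>
  annihilates \<open>\<langle>a, b, d\<rangle>\<close> modulo any ideal that contains all \<open>\<langle>t, _, _\<rangle>\<close> and \<open>skew t _ _ _\<close>.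
\<close>

lemma bracket_mult_bracket:
  assumes "t \<in> carrier R" "q \<in> carrier R" "a \<in> carrier R" "b \<in> carrier R" "d \<in> carrier R"
  shows "\<langle>t, q\<rangle> \<otimes> \<langle>\<langle>a, b\<rangle>, d\<rangle>
    = skew t q \<langle>a, b\<rangle> d \<ominus> (\<langle>t, a, b\<rangle> \<ominus> \<langle>t, b, a\<rangle>) \<otimes> \<langle>q, d\<rangle>"
  unfolding jacobi[OF assms(1,3,4), symmetric] using assms
  by (simp add: skew_defect_def diff_eq_iff)

lemma skew_swap:
  assumes "t \<in> carrier R" "a \<in> carrier R" "b \<in> carrier R" "c \<in> carrier R"
  shows "skew t a b c = skew t b a c"
  using assms by (simp add: expand)

text \<open>
  The ring is the additive span of the words in the generators, and words grow one letter at a time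
  from the left.  This gives an induction step in which one factor is a generator, which is what the
  hypotheses on generators can be applied to.
\<close>

lemma generate_ring_left_induct [consumes 2, case_names one add inv mult]:
  assumes gen: "carrier R = generate_ring R Y" and a: "a \<in> carrier R"
    and one: "P \<one>"
    and add: "\<And>a b. \<lbrakk>a \<in> carrier R; b \<in> carrier R; P a; P b\<rbrakk> \<Longrightarrow> P (a \<oplus> b)"
    and inv: "\<And>a. \<lbrakk>a \<in> carrier R; P a\<rbrakk> \<Longrightarrow> P (\<ominus> a)"
    and mult: "\<And>y a. \<lbrakk>y \<in> Y; a \<in> carrier R; P a\<rbrakk> \<Longrightarrow> P (y \<otimes> a)"
  shows "P a"
proof -
  have "a \<in> generate_ring R Y"
    using a gen by simp
  then have "\<forall>c \<in> carrier R. P c \<longrightarrow> P (a \<otimes> c)"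
  proof (induction rule: generate_ring.induct)
    case (a_inv h)
    then have "h \<in> carrier R" using gen by blast
    with a_inv show ?case by (simp add: l_minus inv)
  next
    case (eng_add h1 h2)
    then have "h1 \<in> carrier R" "h2 \<in> carrier R" using gen by blast+
    with eng_add show ?case by (simp add: l_distr add)
  next
    case (eng_mult h1 h2)
    then have "h1 \<in> carrier R" "h2 \<in> carrier R" using gen by blast+
    with eng_mult show ?case by (simp add: m_assoc)
  qed (use mult in auto)
  then show ?thesis
    using one a by force
qed

end

section \<open>Passing from generators to the whole ring\<close>

context ideal
begin

lemma ideal_add: "\<lbrakk>a \<in> I; b \<in> I\<rbrakk> \<Longrightarrow> a \<oplus> b \<in> I"
  by (rule additive_subgroup.a_closed[OF is_additive_subgroup])

lemma ideal_minus: "a \<in> I \<Longrightarrow> \<ominus> a \<in> I"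
  by (rule additive_subgroup.a_inv_closed[OF is_additive_subgroup])

lemma ideal_diff: "\<lbrakk>a \<in> I; b \<in> I\<rbrakk> \<Longrightarrow> a \<ominus> b \<in> I"
  by (simp add: a_minus_def ideal_add ideal_minus)

lemmas ideal_closed = ideal_add ideal_minus ideal_diff I_l_closed I_r_closed

lemma ideal_bracket:
  assumes "a \<in> I" "b \<in> carrier R"
  shows "\<langle>a, b\<rangle> \<in> I"
  using assms by (simp add: commutator_def ideal_closed)

text \<open>
  The expression is a derivation in \<open>a\<close> modulo \<open>I\<close>, because \<open>v\<close> and \<open>v'\<close> are central modulo \<open>I\<close>.  The
  form with two summands is that of \<open>skew\<close> as a function of its last entry.
\<close>

lemma bracket_sum_extend:
  assumes gen: "carrier R = generate_ring R Y"
    and car: "v \<in> carrier R" "w \<in> carrier R" "v' \<in> carrier R" "w' \<in> carrier R"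
    and central: "\<And>c. c \<in> carrier R \<Longrightarrow> \<langle>v, c\<rangle> \<in> I" "\<And>c. c \<in> carrier R \<Longrightarrow> \<langle>v', c\<rangle> \<in> I"
    and base: "\<And>y. y \<in> Y \<Longrightarrow> v \<otimes> \<langle>w, y\<rangle> \<oplus> v' \<otimes> \<langle>w', y\<rangle> \<in> I"
    and a: "a \<in> carrier R"
  shows "v \<otimes> \<langle>w, a\<rangle> \<oplus> v' \<otimes> \<langle>w', a\<rangle> \<in> I"
  using gen a
proof (induction rule: generate_ring_left_induct)
  case one
  show ?case using car by (simp add: bracket_trivial)
next
  case (add a b)
  have "v \<otimes> \<langle>w, a \<oplus> b\<rangle> \<oplus> v' \<otimes> \<langle>w', a \<oplus> b\<rangle>
    = (v \<otimes> \<langle>w, a\<rangle> \<oplus> v' \<otimes> \<langle>w', a\<rangle>) \<oplus> (v \<otimes> \<langle>w, b\<rangle> \<oplus> v' \<otimes> \<langle>w', b\<rangle>)"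
    using add(1,2) car by (simp add: expand)
  then show ?case using add by (simp add: ideal_closed)
next
  case (inv a)
  have "v \<otimes> \<langle>w, \<ominus> a\<rangle> \<oplus> v' \<otimes> \<langle>w', \<ominus> a\<rangle> = \<ominus> (v \<otimes> \<langle>w, a\<rangle> \<oplus> v' \<otimes> \<langle>w', a\<rangle>)"
    using inv(1) car by (simp add: expand)
  then show ?case using inv by (simp add: ideal_closed)
next
  case (mult y a)
  have y: "y \<in> carrier R"
    using mult(1) gen generate_ring.incl by metis
  have "v \<otimes> \<langle>w, y \<otimes> a\<rangle> \<oplus> v' \<otimes> \<langle>w', y \<otimes> a\<rangle>
    = (v \<otimes> \<langle>w, y\<rangle> \<oplus> v' \<otimes> \<langle>w', y\<rangle>) \<otimes> a \<oplus> y \<otimes> (v \<otimes> \<langle>w, a\<rangle> \<oplus> v' \<otimes> \<langle>w', a\<rangle>)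
      \<oplus> \<langle>v, y\<rangle> \<otimes> \<langle>w, a\<rangle> \<oplus> \<langle>v', y\<rangle> \<otimes> \<langle>w', a\<rangle>"
    using mult(2) y car by (simp add: expand)
  then show ?case using mult y car central base by (simp add: ideal_closed)
qed

lemma bracket_extend:
  assumes gen: "carrier R = generate_ring R Y" and w: "w \<in> carrier R"
    and base: "\<And>y. y \<in> Y \<Longrightarrow> \<langle>w, y\<rangle> \<in> I" and a: "a \<in> carrier R"
  shows "\<langle>w, a\<rangle> \<in> I"
proof -
  have Y: "y \<in> Y \<Longrightarrow> y \<in> carrier R" for y
    using gen generate_ring.incl by metis
  have "\<one> \<otimes> \<langle>w, a\<rangle> \<oplus> \<zero> \<otimes> \<langle>w, a\<rangle> \<in> I"
    by (rule bracket_sum_extend[OF gen]) (use w a base Y in \<open>simp_all add: bracket_trivial\<close>)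
  then show ?thesis using w a by simp
qed

lemma bracket_mult_extend:
  assumes gen: "carrier R = generate_ring R Y" and car: "v \<in> carrier R" "w \<in> carrier R"
    and central: "\<And>c. c \<in> carrier R \<Longrightarrow> \<langle>v, c\<rangle> \<in> I"
    and base: "\<And>y. y \<in> Y \<Longrightarrow> v \<otimes> \<langle>w, y\<rangle> \<in> I" and a: "a \<in> carrier R"
  shows "v \<otimes> \<langle>w, a\<rangle> \<in> I"
proof -
  have Y: "y \<in> Y \<Longrightarrow> y \<in> carrier R" for y
    using gen generate_ring.incl by metis
  have "v \<otimes> \<langle>w, a\<rangle> \<oplus> \<zero> \<otimes> \<langle>w, a\<rangle> \<in> I"
    by (rule bracket_sum_extend[OF gen]) (use car a central base Y in \<open>simp_all add: bracket_trivial\<close>)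
  then show ?thesis using car a by simp
qed

lemma skew_extend_third:
  assumes t: "t \<in> carrier R" and b: "b \<in> carrier R" "c \<in> carrier R"
    and z: "z \<in> carrier R" "a \<in> carrier R"
    and "\<langle>t, b, z\<rangle> \<in> I" "skew t b z c \<in> I" "skew t b a c \<in> I"
    and "\<langle>t, z\<rangle> \<otimes> \<langle>\<langle>b, c\<rangle>, a\<rangle> \<in> I"
  shows "skew t b (z \<otimes> a) c \<in> I"
proof -
  have "\<langle>t, z\<rangle> \<otimes> \<langle>a, \<langle>b, c\<rangle>\<rangle> = \<ominus> (\<langle>t, z\<rangle> \<otimes> \<langle>\<langle>b, c\<rangle>, a\<rangle>)"
    using t b z by (simp add: expand)
  then show ?thesis
    using assms by (simp add: skew_mult_third ideal_closed)
qed

lemma skew_additive: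
  assumes "t \<in> carrier R" "b \<in> carrier R" "a \<in> carrier R" "a' \<in> carrier R" "c \<in> carrier R"
  shows "skew t b (a \<oplus> a') c = skew t b a c \<oplus> skew t b a' c"
    and "skew t b (\<ominus> a) c = \<ominus> skew t b a c"
    and "skew t b \<one> c = \<zero>"
  using assms by (simp_all add: expand)

text \<open>
  The order in which the entries are freed matters.  The entry \<open>a\<close> of \<open>skew t x a c\<close> can be extended
  once \<open>\<langle>t, z\<rangle> \<langle>\<langle>x, c\<rangle>, a\<rangle>\<close> is known to lie in \<open>I\<close> for generators \<open>z\<close>.  For \<open>x\<close> and \<open>c\<close> generators this
  follows from the third hypothesis.  The entry \<open>a\<close> of \<open>\<langle>t, a, x\<rangle>\<close> and \<open>skew t x a c\<close> is therefore
  freed first, in a common induction because the step for the former uses the latter; then \<open>c\<close> is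
  freed, as \<open>\<langle>t, x\<rangle>\<close> and \<open>\<langle>t, a\<rangle>\<close> are now central modulo \<open>I\<close>.  From then on \<open>bracket_mult_bracket\<close> supplies the missing membership for
  arbitrary \<open>b\<close> and \<open>c\<close>, and the remaining generator can be freed as well.
\<close>

lemma entries_extend:
  assumes gen: "carrier R = generate_ring R Y" and t: "t \<in> carrier R"
    and h1: "\<And>x y. \<lbrakk>x \<in> Y; y \<in> Y\<rbrakk> \<Longrightarrow> \<langle>t, x, y\<rangle> \<in> I"
    and h2: "\<And>x y z. \<lbrakk>x \<in> Y; y \<in> Y; z \<in> Y\<rbrakk> \<Longrightarrow> skew t x y z \<in> I"
    and h3: "\<And>x y z w. \<lbrakk>x \<in> Y; y \<in> Y; z \<in> Y; w \<in> Y\<rbrakk> \<Longrightarrow> \<langle>t, x\<rangle> \<otimes> \<langle>y, z, w\<rangle> \<in> I"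
  shows "\<And>a b. \<lbrakk>a \<in> carrier R; b \<in> carrier R\<rbrakk> \<Longrightarrow> \<langle>t, a, b\<rangle> \<in> I"
    and "\<And>a b c. \<lbrakk>a \<in> carrier R; b \<in> carrier R; c \<in> carrier R\<rbrakk> \<Longrightarrow> skew t a b c \<in> I"
proof -
  have Y: "y \<in> Y \<Longrightarrow> y \<in> carrier R" for y
    using gen generate_ring.incl by metis
  have cY: "\<langle>t, x, a\<rangle> \<in> I" if "x \<in> Y" "a \<in> carrier R" for x a
    unfolding commutator3_def
    by (rule bracket_extend[OF gen]) (use that Y t h1 in \<open>simp_all add: commutator3_def\<close>)
  have kY: "\<langle>t, x\<rangle> \<otimes> \<langle>\<langle>y, z\<rangle>, a\<rangle> \<in> I" if "x \<in> Y" "y \<in> Y" "z \<in> Y" "a \<in> carrier R" for x y z a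
    by (rule bracket_mult_extend[OF gen])
      (use that Y t cY h3 in \<open>simp_all add: commutator3_def\<close>)
  have step: "(\<forall>x \<in> Y. \<langle>t, a, x\<rangle> \<in> I) \<and> (\<forall>x \<in> Y. \<forall>c \<in> Y. skew t x a c \<in> I)"
    if "a \<in> carrier R" for a
    using gen that
  proof (induction rule: generate_ring_left_induct)
    case one
    show ?case using t Y by (simp add: commutator3_def bracket_trivial skew_additive)
  next
    case (add a b)
    then show ?case
      using t Y by (simp add: commutator3_def bracket_linear skew_additive ideal_closed)
  next
    case (inv a)
    then show ?case
      using t Y by (simp add: commutator3_def bracket_linear skew_additive ideal_closed)
  next
    case (mult z a)
    have z: "z \<in> carrier R" using mult(1) Y by simp
    have a: "\<langle>t, a, c\<rangle> \<in> I" if "c \<in> carrier R" for c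
      unfolding commutator3_def
      by (rule bracket_extend[OF gen])
        (use that Y t mult in \<open>simp_all add: commutator3_def\<close>)
    have "\<langle>t, z \<otimes> a, x\<rangle> \<in> I" if x: "x \<in> Y" for x
    proof -
      have "\<langle>t, z \<otimes> a, x\<rangle> = z \<otimes> \<langle>t, a, x\<rangle> \<oplus> \<langle>t, z, x\<rangle> \<otimes> a \<oplus> skew t z a x \<ominus> \<langle>t, a, \<langle>z, x\<rangle>\<rangle>"
        using t z mult(2) Y[OF x] by (simp add: expand)
      then show ?thesis
        using t z x Y mult a cY by (simp add: ideal_closed)
    qed
    moreover have "skew t x (z \<otimes> a) c \<in> I" if "x \<in> Y" "c \<in> Y" for x c
      by (rule skew_extend_third) (use that t z mult Y h1 h2 kY in simp_all)
    ultimately show ?case by simp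
  qed
  show central: "\<langle>t, a, b\<rangle> \<in> I" if "a \<in> carrier R" "b \<in> carrier R" for a b
    unfolding commutator3_def
    by (rule bracket_extend[OF gen]) (use that Y t step in \<open>simp_all add: commutator3_def\<close>)
  have sY: "skew t x a c \<in> I" if "x \<in> Y" "a \<in> carrier R" "c \<in> carrier R" for x a c
    unfolding skew_defect_def
    by (rule bracket_sum_extend[OF gen])
      (use that t Y step central in \<open>simp_all add: commutator3_def skew_defect_def\<close>)
  show "skew t b a c \<in> I" if b: "b \<in> carrier R" and "a \<in> carrier R" and c: "c \<in> carrier R" for b a c
    using gen that(2)
  proof (induction rule: generate_ring_left_induct)
    case one
    show ?case using t b c by (simp add: skew_additive)
  next
    case (add a a')
    then show ?case using t b c by (simp add: skew_additive ideal_closed)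
  next
    case (inv a)
    then show ?case using t b c by (simp add: skew_additive ideal_closed)
  next
    case (mult z a)
    have z: "z \<in> carrier R" using mult(1) Y by simp
    have "\<langle>t, z\<rangle> \<otimes> \<langle>\<langle>b, c\<rangle>, a\<rangle> \<in> I"
      using t z b c mult sY central by (simp add: bracket_mult_bracket ideal_closed)
    then show ?case
      by (intro skew_extend_third)
        (use t z b c mult central sY in \<open>simp_all add: skew_swap[of t b z]\<close>)
  qed
qed

text \<open>
  Fixing a generator in the first place, the previous lemma frees the other entries.  The symmetries
  \<open>\<langle>d, x, y\<rangle> = - \<langle>x, d, y\<rangle>\<close> and \<open>skew d x y z = - skew x y d z - skew y x d z\<close> move the generator out
  of the first place, so that the lemma applies a second time, now with an arbitrary element there.
\<close>

lemma all_entries_extend: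
  assumes gen: "carrier R = generate_ring R Y"
    and h1: "\<And>x y z. \<lbrakk>x \<in> Y; y \<in> Y; z \<in> Y\<rbrakk> \<Longrightarrow> \<langle>x, y, z\<rangle> \<in> I"
    and h2: "\<And>x y z w. \<lbrakk>x \<in> Y; y \<in> Y; z \<in> Y; w \<in> Y\<rbrakk> \<Longrightarrow> skew x y z w \<in> I"
  shows "\<And>a b c. \<lbrakk>a \<in> carrier R; b \<in> carrier R; c \<in> carrier R\<rbrakk> \<Longrightarrow> \<langle>a, b, c\<rangle> \<in> I"
    and "\<And>a b c d. \<lbrakk>a \<in> carrier R; b \<in> carrier R; c \<in> carrier R; d \<in> carrier R\<rbrakk>
      \<Longrightarrow> skew a b c d \<in> I"
proof -
  have Y: "y \<in> Y \<Longrightarrow> y \<in> carrier R" for y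
    using gen generate_ring.incl by metis
  have x1: "\<langle>x, a, b\<rangle> \<in> I" if "x \<in> Y" "a \<in> carrier R" "b \<in> carrier R" for x a b
    by (rule entries_extend(1)[OF gen]) (use that Y h1 h2 in \<open>simp_all add: ideal_closed\<close>)
  have x2: "skew x a b c \<in> I"
    if "x \<in> Y" "a \<in> carrier R" "b \<in> carrier R" "c \<in> carrier R" for x a b c
    by (rule entries_extend(2)[OF gen]) (use that Y h1 h2 in \<open>simp_all add: ideal_closed\<close>)
  have d1: "\<langle>d, x, y\<rangle> \<in> I" if d: "d \<in> carrier R" and xy: "x \<in> Y" "y \<in> Y" for d x y
  proof -
    have "\<langle>d, x, y\<rangle> = \<ominus> \<langle>x, d, y\<rangle>"
      using d Y xy by (simp add: expand)
    then show ?thesis using d xy Y x1 by (simp add: ideal_closed)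
  qed
  have d2: "skew d x y z \<in> I"
    if d: "d \<in> carrier R" and xyz: "x \<in> Y" "y \<in> Y" "z \<in> Y" for d x y z
  proof -
    have "skew d x y z = \<ominus> (skew x y d z \<oplus> skew y x d z)"
      using d Y xyz by (simp add: expand)
    then show ?thesis using d xyz Y x2 by (simp add: ideal_closed)
  qed
  show "\<langle>d, a, b\<rangle> \<in> I" if "d \<in> carrier R" "a \<in> carrier R" "b \<in> carrier R" for d a b
    by (rule entries_extend(1)[OF gen]) (use that Y h1 d1 d2 in \<open>simp_all add: ideal_closed\<close>)
  show "skew d a b c \<in> I"
    if "d \<in> carrier R" "a \<in> carrier R" "b \<in> carrier R" "c \<in> carrier R" for d a b c
    by (rule entries_extend(2)[OF gen]) (use that Y h1 d1 d2 in \<open>simp_all add: ideal_closed\<close>)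
qed

section \<open>The largest ideal whose double commutators lie in a given ideal\<close>

text \<open>
  The factor \<open>p\<close> in the last two conditions makes them stable under multiplication of \<open>u\<close> on either
  side without further argument.
\<close>

definition tame :: "'a set"
  where "tame = {u \<in> carrier R.
     (\<forall>a \<in> carrier R. \<forall>b \<in> carrier R. \<langle>u, a, b\<rangle> \<in> I) \<and>
     (\<forall>a \<in> carrier R. \<forall>b \<in> carrier R. \<forall>c \<in> carrier R. skew u a b c \<in> I) \<and>
     (\<forall>p \<in> carrier R. \<forall>a \<in> carrier R. \<forall>b \<in> carrier R. \<forall>c \<in> carrier R.
        u \<otimes> p \<otimes> \<langle>a, b, c\<rangle> \<in> I) \<and>
     (\<forall>p \<in> carrier R. \<forall>a \<in> carrier R. \<forall>b \<in> carrier R. \<forall>c \<in> carrier R. \<forall>d \<in> carrier R.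
        u \<otimes> p \<otimes> skew a b c d \<in> I)}"

lemma tameD:
  assumes u: "u \<in> tame"
  shows "u \<in> carrier R"
    and "\<lbrakk>a \<in> carrier R; b \<in> carrier R\<rbrakk> \<Longrightarrow> \<langle>u, a, b\<rangle> \<in> I"
    and "\<lbrakk>a \<in> carrier R; b \<in> carrier R; c \<in> carrier R\<rbrakk> \<Longrightarrow> skew u a b c \<in> I"
    and "\<lbrakk>p \<in> carrier R; a \<in> carrier R; b \<in> carrier R; c \<in> carrier R\<rbrakk>
      \<Longrightarrow> u \<otimes> p \<otimes> \<langle>a, b, c\<rangle> \<in> I"
    and "\<lbrakk>p \<in> carrier R; a \<in> carrier R; b \<in> carrier R; c \<in> carrier R; d \<in> carrier R\<rbrakk>
      \<Longrightarrow> u \<otimes> p \<otimes> skew a b c d \<in> I"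
  using u by (simp_all add: tame_def)

lemma tame_mult:
  assumes u: "u \<in> tame" and car: "a \<in> carrier R" "b \<in> carrier R" "c \<in> carrier R"
  shows "u \<otimes> \<langle>a, b, c\<rangle> \<in> I"
    and "d \<in> carrier R \<Longrightarrow> u \<otimes> skew a b c d \<in> I"
    and "d \<in> carrier R \<Longrightarrow> \<langle>u, d\<rangle> \<otimes> \<langle>a, b, c\<rangle> \<in> I"
proof -
  have uc: "u \<in> carrier R" by (rule tameD(1)[OF u])
  show k: "u \<otimes> \<langle>a, b, c\<rangle> \<in> I"
    using tameD(4)[OF u one_closed car] uc car by simp
  show "u \<otimes> skew a b c d \<in> I" if "d \<in> carrier R"
    using tameD(5)[OF u one_closed car that] uc car that by simp
  show "\<langle>u, d\<rangle> \<otimes> \<langle>a, b, c\<rangle> \<in> I" if d: "d \<in> carrier R"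
  proof -
    have "\<langle>u, d\<rangle> \<otimes> \<langle>a, b, c\<rangle> = u \<otimes> d \<otimes> \<langle>a, b, c\<rangle> \<ominus> d \<otimes> (u \<otimes> \<langle>a, b, c\<rangle>)"
      using uc car d by (simp add: commutator_def diff_rules m_assoc)
    then show ?thesis
      using tameD(4)[OF u d car] k uc car d by (simp add: ideal_closed)
  qed
qed

lemma tame_diff:
  assumes "u \<in> tame" "v \<in> tame"
  shows "u \<ominus> v \<in> tame"
proof -
  have car: "u \<in> carrier R" "v \<in> carrier R"
    using assms by (simp_all add: tame_def)
  have "\<langle>u \<ominus> v, a, b\<rangle> = \<langle>u, a, b\<rangle> \<ominus> \<langle>v, a, b\<rangle>"
    if "a \<in> carrier R" "b \<in> carrier R" for a b
    using car that by (simp add: expand)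
  moreover have "skew (u \<ominus> v) a b c = skew u a b c \<ominus> skew v a b c"
    if "a \<in> carrier R" "b \<in> carrier R" "c \<in> carrier R" for a b c
    using car that by (simp add: expand)
  ultimately show ?thesis
    using assms by (simp add: tame_def ideal_closed diff_rules)
qed

lemma tame_mult_right:
  assumes u: "u \<in> tame" and q: "q \<in> carrier R"
  shows "u \<otimes> q \<in> tame"
proof -
  have uc: "u \<in> carrier R" using u by (simp add: tame_def)
  have "\<langle>u \<otimes> q, a, b\<rangle> \<in> I" if "a \<in> carrier R" "b \<in> carrier R" for a b
    using that uc q tameD[OF u] tame_mult[OF u] by (simp add: bracket3_mult ideal_closed)
  moreover have "skew (u \<otimes> q) a b c \<in> I"
    if "a \<in> carrier R" "b \<in> carrier R" "c \<in> carrier R" for a b c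
    using that uc q tameD[OF u] tame_mult[OF u] by (simp add: skew_mult_first ideal_closed)
  moreover have "u \<otimes> q \<otimes> p = u \<otimes> (q \<otimes> p)" if "p \<in> carrier R" for p
    using that uc q by (simp add: m_assoc)
  ultimately show ?thesis
    using uc q tameD(4,5)[OF u] by (simp add: tame_def)
qed

text \<open>
  Closure under left multiplication is reduced to this by \<open>p u = u p - \<langle>u, p\<rangle>\<close>.  A bracket is easier to
  handle than a product because \<open>\<langle>\<langle>u, p\<rangle>, a\<rangle>\<close> already lies in \<open>I\<close>.
\<close>

lemma tame_bracket:
  assumes u: "u \<in> tame" and p: "p \<in> carrier R"
  shows "\<langle>u, p\<rangle> \<in> tame"
proof -
  have uc: "u \<in> carrier R" using u by (simp add: tame_def)
  have up: "\<langle>\<langle>u, p\<rangle>, a\<rangle> \<in> I" if "a \<in> carrier R" for a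
    using u p that by (simp add: tame_def commutator3_def)
  have d: "\<langle>u, p\<rangle> \<otimes> r \<otimes> z = u \<otimes> (p \<otimes> r) \<otimes> z \<ominus> p \<otimes> (u \<otimes> r \<otimes> z)"
    if "r \<in> carrier R" "z \<in> carrier R" for r z
    using uc p that by (simp add: expand)
  show ?thesis
    using uc p tameD(4,5)[OF u]
    by (simp add: tame_def commutator3_def[of R "\<langle>u, p\<rangle>"] skew_defect_def[of R "\<langle>u, p\<rangle>"] d up
        ideal_bracket ideal_closed)
qed

lemma ideal_tame: "ideal tame R"
proof (rule idealI[OF ring_axioms])
  have zero: "\<zero> \<in> tame"
    by (simp add: tame_def commutator3_def skew_defect_def bracket_trivial)
  have car: "u \<in> tame \<Longrightarrow> u \<in> carrier R" for u by (simp add: tame_def)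
  have inv: "\<ominus> u \<in> tame" if "u \<in> tame" for u
    using tame_diff[OF zero that] car[OF that] by (simp add: minus_eq_zero_diff)
  have add: "u \<oplus> v \<in> tame" if "u \<in> tame" "v \<in> tame" for u v
    using tame_diff[OF that(1) inv[OF that(2)]] that car by (simp add: a_minus_def)
  show "subgroup tame (add_monoid R)"
    by (rule add.subgroupI) (use zero car inv add in \<open>auto simp: a_inv_def\<close>)
  show "p \<otimes> u \<in> tame" if "u \<in> tame" "p \<in> carrier R" for u p
  proof -
    have "p \<otimes> u = u \<otimes> p \<ominus> \<langle>u, p\<rangle>"
      using that car by (simp add: expand)
    then show ?thesis using that tame_diff tame_mult_right tame_bracket by simp
  qed
qed (rule tame_mult_right)

text \<open>
  Since \<open>u d\<close> belongs to \<open>U\<close> together with \<open>u\<close>, the Leibniz expansion of \<open>\<langle>u d, a, b\<rangle>\<close> lies in \<open>I\<close>.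
  Antisymmetrizing it in \<open>a\<close> and \<open>b\<close> removes the mixed terms and leaves \<open>u \<langle>a, b, d\<rangle>\<close>, by the Jacobi
  identity; the mixed terms themselves then give \<open>skew u a b d\<close>.  Replacing \<open>u\<close> by \<open>u a\<close> in the
  latter gives \<open>u (skew a b d e)\<close>.
\<close>

lemma subset_tame:
  assumes U: "ideal U R"
    and c: "\<And>u a b. \<lbrakk>u \<in> U; a \<in> carrier R; b \<in> carrier R\<rbrakk> \<Longrightarrow> \<langle>u, a, b\<rangle> \<in> I"
  shows "U \<subseteq> tame"
proof
  have car: "u \<in> U \<Longrightarrow> u \<in> carrier R" for u
    using ideal.Icarr[OF U] .
  have mult: "u \<otimes> q \<in> U" if "u \<in> U" "q \<in> carrier R" for u q
    using ideal.I_r_closed[OF U that] .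
  have k: "u \<otimes> \<langle>a, b, d\<rangle> \<in> I"
    if u: "u \<in> U" and abd: "a \<in> carrier R" "b \<in> carrier R" "d \<in> carrier R" for u a b d
  proof -
    have "u \<otimes> \<langle>a, b, d\<rangle>
      = \<langle>u, a, b\<rangle> \<otimes> d \<ominus> \<langle>u, b, a\<rangle> \<otimes> d \<ominus> \<langle>u \<otimes> d, a, b\<rangle> \<oplus> \<langle>u \<otimes> d, b, a\<rangle>"
      using car[OF u] abd by (simp add: expand)
    then show ?thesis using u abd c mult by (simp add: ideal_closed)
  qed
  have s: "skew u a b d \<in> I"
    if u: "u \<in> U" and abd: "a \<in> carrier R" "b \<in> carrier R" "d \<in> carrier R" for u a b d
  proof -
    have "skew u a b d = \<langle>u, a, b\<rangle> \<otimes> d \<oplus> u \<otimes> \<langle>d, a, b\<rangle> \<ominus> \<langle>u \<otimes> d, a, b\<rangle>"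
      using car[OF u] abd by (simp add: expand)
    then show ?thesis using u abd c mult k by (simp add: ideal_closed)
  qed
  have us: "u \<otimes> skew a b d e \<in> I"
    if u: "u \<in> U" and abde: "a \<in> carrier R" "b \<in> carrier R" "d \<in> carrier R" "e \<in> carrier R"
    for u a b d e
  proof -
    have "u \<otimes> skew a b d e = skew (u \<otimes> a) b d e \<ominus> a \<otimes> skew u b d e
      \<ominus> \<langle>u, b, a\<rangle> \<otimes> \<langle>d, e\<rangle> \<ominus> \<langle>u, d, a\<rangle> \<otimes> \<langle>b, e\<rangle>"
      using car[OF u] abde by (simp add: expand)
    then show ?thesis using u abde c mult s by (simp add: ideal_closed)
  qed
  show "u \<in> tame" if "u \<in> U" for u
    using that car mult c s k us by (simp add: tame_def)
qed

section \<open>Testing membership on ring generators\<close>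

text \<open>
  Modulo \<open>I\<close>, the product \<open>\<langle>t, q\<rangle> \<langle>a, b\<rangle> \<langle>d, e\<rangle>\<close> changes sign under exchanging \<open>q\<close> with \<open>a\<close>, \<open>a\<close> with
  \<open>b\<close>, and, as the two rightmost brackets commute after \<open>\<langle>t, q\<rangle>\<close>, also \<open>q\<close> with \<open>d\<close>.  These exchanges
  generate the one of \<open>b\<close> with \<open>d\<close>, which is the second claim.
\<close>

lemma bracket_annihilates:
  assumes t: "t \<in> carrier R"
    and c: "\<And>a b. \<lbrakk>a \<in> carrier R; b \<in> carrier R\<rbrakk> \<Longrightarrow> \<langle>t, a, b\<rangle> \<in> I"
    and s: "\<And>a b c. \<lbrakk>a \<in> carrier R; b \<in> carrier R; c \<in> carrier R\<rbrakk> \<Longrightarrow> skew t a b c \<in> I"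
    and car: "q \<in> carrier R" "a \<in> carrier R" "b \<in> carrier R" "d \<in> carrier R" "e \<in> carrier R"
  shows "\<langle>t, q\<rangle> \<otimes> \<langle>\<langle>a, b\<rangle>, d\<rangle> \<in> I" and "\<langle>t, q\<rangle> \<otimes> skew a b d e \<in> I"
proof -
  have k: "\<langle>t, q\<rangle> \<otimes> \<langle>\<langle>a, b\<rangle>, d\<rangle> \<in> I"
    if "q \<in> carrier R" "a \<in> carrier R" "b \<in> carrier R" "d \<in> carrier R" for q a b d
    using t that c s by (simp add: bracket_mult_bracket ideal_closed)
  then show "\<langle>t, q\<rangle> \<otimes> \<langle>\<langle>a, b\<rangle>, d\<rangle> \<in> I" using car by simp
  have swap: "\<langle>b, a\<rangle> = \<ominus> \<langle>a, b\<rangle>" "\<langle>d, a\<rangle> = \<ominus> \<langle>a, d\<rangle>"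
    using car by (simp_all add: expand)
  \<comment> \<open>The exchanges in turn: \<open>\<langle>t, q\<rangle> \<langle>a, b\<rangle>\<close> becomes \<open>\<langle>t, b\<rangle> \<langle>q, a\<rangle>\<close>, the factor \<open>\<langle>q, a\<rangle>\<close> is moved
    to the far right, and what remains on its left in the
    two summands adds up to \<open>skew t b d e\<close>.\<close>
  have "\<langle>t, q\<rangle> \<otimes> skew a b d e = skew t b d e \<otimes> \<langle>q, a\<rangle>
      \<oplus> \<langle>t, b\<rangle> \<otimes> \<langle>\<langle>q, a\<rangle>, \<langle>d, e\<rangle>\<rangle> \<oplus> \<langle>t, d\<rangle> \<otimes> \<langle>\<langle>q, a\<rangle>, \<langle>b, e\<rangle>\<rangle>
      \<ominus> skew t q b a \<otimes> \<langle>d, e\<rangle> \<ominus> skew t q d a \<otimes> \<langle>b, e\<rangle>"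
    using t car
    by (simp add: skew_defect_def swap commutator_def[of R "\<langle>q, a\<rangle>"] normalize)
  then show "\<langle>t, q\<rangle> \<otimes> skew a b d e \<in> I"
    using t car s k by (simp add: ideal_closed)
qed

text \<open>
  The elements \<open>z\<close> with \<open>t z\<close> in \<open>I\<close> form only a right ideal; the factor \<open>a\<close> in the
  middle makes the set two-sided.
\<close>

lemma ideal_annihilator:
  assumes t: "t \<in> carrier R"
  shows "ideal {z \<in> carrier R. \<forall>a \<in> carrier R. t \<otimes> a \<otimes> z \<in> I} R" (is "ideal ?J R")
proof (rule idealI[OF ring_axioms])
  show "subgroup ?J (add_monoid R)"
  proof (rule add.subgroupI)
    show "?J \<noteq> {}" using t by (auto intro!: exI[of _ \<zero>])
    show "\<ominus> z \<in> ?J" if "z \<in> ?J" for z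
      using that t by (simp add: ideal_closed r_minus)
  qed (use t in \<open>auto simp: ideal_closed r_distr\<close>)
  show "x \<otimes> z \<in> ?J" if "z \<in> ?J" "x \<in> carrier R" for z x
  proof -
    have "t \<otimes> a \<otimes> (x \<otimes> z) = t \<otimes> (a \<otimes> x) \<otimes> z" if "a \<in> carrier R" for a
      using that \<open>z \<in> ?J\<close> \<open>x \<in> carrier R\<close> t by (simp add: m_assoc)
    then show ?thesis using that by simp
  qed
  show "z \<otimes> x \<in> ?J" if "z \<in> ?J" "x \<in> carrier R" for z x
    using that t by (simp add: m_assoc[symmetric] I_r_closed)
qed

lemma mem_tame:
  assumes gen: "carrier R = generate_ring R Y" and s: "s \<in> carrier R"
    and h1: "\<And>x y. \<lbrakk>x \<in> Y; y \<in> Y\<rbrakk> \<Longrightarrow> \<langle>s, x, y\<rangle> \<in> I"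
    and h2: "\<And>x y z. \<lbrakk>x \<in> Y; y \<in> Y; z \<in> Y\<rbrakk> \<Longrightarrow> s \<otimes> \<langle>x, y, z\<rangle> \<in> I"
    and h3: "\<And>x y z w. \<lbrakk>x \<in> Y; y \<in> Y; z \<in> Y; w \<in> Y\<rbrakk> \<Longrightarrow> \<langle>s, x\<rangle> \<otimes> \<langle>y, z, w\<rangle> \<in> I"
    and h4: "\<And>x y z. \<lbrakk>x \<in> Y; y \<in> Y; z \<in> Y\<rbrakk> \<Longrightarrow> skew s x y z \<in> I"
    and h5: "\<And>x y z w. \<lbrakk>x \<in> Y; y \<in> Y; z \<in> Y; w \<in> Y\<rbrakk> \<Longrightarrow> s \<otimes> skew x y z w \<in> I"
  shows "s \<in> tame"
proof -
  have Y: "y \<in> Y \<Longrightarrow> y \<in> carrier R" for y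
    using gen generate_ring.incl by metis
  have c: "\<langle>s, a, b\<rangle> \<in> I" if "a \<in> carrier R" "b \<in> carrier R" for a b
    using entries_extend(1)[OF gen s h1 h4 h3] that by blast
  have k: "skew s a b d \<in> I" if "a \<in> carrier R" "b \<in> carrier R" "d \<in> carrier R" for a b d
    using entries_extend(2)[OF gen s h1 h4 h3] that by blast
  let ?J = "{z \<in> carrier R. \<forall>a \<in> carrier R. s \<otimes> a \<otimes> z \<in> I}"
  have J: "ideal ?J R" by (rule ideal_annihilator[OF s])
  have move: "s \<otimes> a \<otimes> z = a \<otimes> (s \<otimes> z) \<oplus> \<langle>s, a\<rangle> \<otimes> z"
    if "a \<in> carrier R" "z \<in> carrier R" for a z
    using that s by (simp add: expand)
  have J1: "\<langle>x, y, z\<rangle> \<in> ?J" if "x \<in> Y" "y \<in> Y" "z \<in> Y" for x y z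
    using that Y s h2 bracket_annihilates(1)[OF s c k]
    by (simp add: move ideal_closed commutator3_def)
  have J2: "skew x y z w \<in> ?J" if "x \<in> Y" "y \<in> Y" "z \<in> Y" "w \<in> Y" for x y z w
    using that Y s h5 bracket_annihilates(2)[OF s c k]
    by (simp add: move ideal_closed)
  have "\<langle>a, b, d\<rangle> \<in> ?J" if "a \<in> carrier R" "b \<in> carrier R" "d \<in> carrier R" for a b d
    using ideal.all_entries_extend(1)[OF J gen J1 J2] that by blast
  moreover have "skew a b d e \<in> ?J"
    if "a \<in> carrier R" "b \<in> carrier R" "d \<in> carrier R" "e \<in> carrier R" for a b d e
    using ideal.all_entries_extend(2)[OF J gen J1 J2] that by blast
  ultimately show ?thesis
    using s c k by (simp add: tame_def)
qed

end

section \<open>Scalars among the ring generators\<close>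

context assoc_algebra
begin

lemma scalar_central:
  assumes "r \<in> carrier R" "a \<in> carrier A"
  shows "commutator A (r \<odot>\<^bsub>A\<^esub> \<one>) a = \<zero>" and "commutator A a (r \<odot>\<^bsub>A\<^esub> \<one>) = \<zero>"
  using assms
  by (simp_all add: commutator_def smult_mult_left smult_mult_right a_minus_def r_neg)

text \<open>
  A subring that contains the multiples of \<open>\<one>\<close> is stable under scalar multiplication, since
  \<open>r a = (r 1) a\<close>.
\<close>

lemma generate_ring_scalars:
  assumes X: "X \<subseteq> carrier A" and gen: "generated_algebra R A X = carrier A"
  shows "carrier A = generate_ring A (X \<union> {r \<odot>\<^bsub>A\<^esub> \<one> | r. r \<in> carrier R})" (is "_ = ?G")
proof
  have Y: "X \<union> {r \<odot>\<^bsub>A\<^esub> \<one> | r. r \<in> carrier R} \<subseteq> carrier A"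
    using X by auto
  show "?G \<subseteq> carrier A" by (rule generate_ring_incl[OF Y])
  have sub: "subring ?G A" by (rule generate_ring_is_subring[OF Y])
  have "r \<odot>\<^bsub>A\<^esub> a \<in> ?G" if r: "r \<in> carrier R" and a: "a \<in> ?G" for r a
  proof -
    have "r \<odot>\<^bsub>A\<^esub> \<one> \<in> ?G"
      using r by (intro generate_ring.incl) auto
    then have "(r \<odot>\<^bsub>A\<^esub> \<one>) \<otimes> a \<in> ?G"
      using a by (rule generate_ring.eng_mult)
    moreover have "a \<in> carrier A" using a generate_ring_in_carrier[OF Y] by blast
    ultimately show ?thesis using r by (simp add: smult_mult_left)
  qed
  then have "unital_subalgebra ?G R A"
    using sub by (simp add: unital_subalgebra_def submodule_def submodule_axioms_def subring_def)
  then show "carrier A \<subseteq> ?G"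
    unfolding gen[symmetric] generated_algebra_def by (auto intro: generate_ring.incl)
qed

end

theorem theorem1p4:
  fixes R :: "('r, 'n) ring_scheme"
    and A :: "('r, 'a, 'm) module_scheme" (structure)
    and X S U W :: "'a set"
  assumes "assoc_algebra R A"
    and "X \<subseteq> carrier A" and "generated_algebra R A X = carrier A"
    and "S \<subseteq> carrier A" and "U = Idl\<^bsub>A\<^esub> S"
    and "W = Idl\<^bsub>A\<^esub> {commutator3 A u a1 a2 | u a1 a2.
                    u \<in> U \<and> a1 \<in> carrier A \<and> a2 \<in> carrier A}"
  shows "W = Idl\<^bsub>A\<^esub>
     ({commutator3 A s x1 x2 | s x1 x2. s \<in> S \<and> x1 \<in> X \<and> x2 \<in> X}
    \<union> {s \<otimes> commutator3 A x1 x2 x3 | s x1 x2 x3.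
          s \<in> S \<and> x1 \<in> X \<and> x2 \<in> X \<and> x3 \<in> X}
    \<union> {commutator A s x1 \<otimes> commutator3 A x2 x3 x4 | s x1 x2 x3 x4.
          s \<in> S \<and> x1 \<in> X \<and> x2 \<in> X \<and> x3 \<in> X \<and> x4 \<in> X}
    \<union> {commutator A s x1 \<otimes> commutator A x2 x3 \<oplus> commutator A s x2 \<otimes> commutator A x1 x3
          | s x1 x2 x3. s \<in> S \<and> x1 \<in> X \<and> x2 \<in> X \<and> x3 \<in> X}
    \<union> {s \<otimes> (commutator A x1 x2 \<otimes> commutator A x3 x4
             \<oplus> commutator A x1 x3 \<otimes> commutator A x2 x4)
          | s x1 x2 x3 x4. s \<in> S \<and> x1 \<in> X \<and> x2 \<in> X \<and> x3 \<in> X \<and> x4 \<in> X})"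
proof -
  interpret assoc_algebra R A by fact
  have X: "x \<in> X \<Longrightarrow> x \<in> carrier A" and S: "s \<in> S \<Longrightarrow> s \<in> carrier A" for x s
    using assms(2,4) by blast+
  let ?T = "{commutator3 A u a1 a2 | u a1 a2. u \<in> U \<and> a1 \<in> carrier A \<and> a2 \<in> carrier A}"
  show ?thesis (is "W = Idl\<^bsub>A\<^esub> ?F")
  proof -
    define F where "F = ?F"
    have F_mem:
      "\<lbrakk>s \<in> S; x \<in> X; y \<in> X\<rbrakk> \<Longrightarrow> commutator3 A s x y \<in> F"
      "\<lbrakk>s \<in> S; x \<in> X; y \<in> X; z \<in> X\<rbrakk> \<Longrightarrow> s \<otimes> commutator3 A x y z \<in> F"
      "\<lbrakk>s \<in> S; x \<in> X; y \<in> X; z \<in> X; w \<in> X\<rbrakk> \<Longrightarrow> commutator A s x \<otimes> commutator3 A y z w \<in> F"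
      "\<lbrakk>s \<in> S; x \<in> X; y \<in> X; z \<in> X\<rbrakk> \<Longrightarrow> skew_defect A s x y z \<in> F"
      "\<lbrakk>s \<in> S; x \<in> X; y \<in> X; z \<in> X; w \<in> X\<rbrakk> \<Longrightarrow> s \<otimes> skew_defect A x y z w \<in> F"
      for s x y z w
      unfolding F_def skew_defect_def
      subgoal by (intro UnI1) blast
      subgoal by (rule UnI1, rule UnI1, rule UnI1, rule UnI2) blast
      subgoal by (rule UnI1, rule UnI1, rule UnI2) blast
      subgoal by (rule UnI1, rule UnI2) blast
      subgoal by (rule UnI2) blast
      done
    have F_least: "F \<subseteq> Z"
      if "\<And>s x y. \<lbrakk>s \<in> S; x \<in> X; y \<in> X\<rbrakk> \<Longrightarrow> commutator3 A s x y \<in> Z"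
        "\<And>s x y z. \<lbrakk>s \<in> S; x \<in> X; y \<in> X; z \<in> X\<rbrakk> \<Longrightarrow> s \<otimes> commutator3 A x y z \<in> Z"
        "\<And>s x y z w. \<lbrakk>s \<in> S; x \<in> X; y \<in> X; z \<in> X; w \<in> X\<rbrakk>
          \<Longrightarrow> commutator A s x \<otimes> commutator3 A y z w \<in> Z"
        "\<And>s x y z. \<lbrakk>s \<in> S; x \<in> X; y \<in> X; z \<in> X\<rbrakk> \<Longrightarrow> skew_defect A s x y z \<in> Z"
        "\<And>s x y z w. \<lbrakk>s \<in> S; x \<in> X; y \<in> X; z \<in> X; w \<in> X\<rbrakk>
          \<Longrightarrow> s \<otimes> skew_defect A x y z w \<in> Z"
      for Z
      unfolding F_def skew_defect_def[symmetric]
      by (intro Un_least subsetI; elim CollectE exE conjE) (use that in simp_all)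
    have F: "F \<subseteq> carrier A"
      by (rule F_least) (simp_all add: X S)
    have U: "ideal U A"
      unfolding assms(5) by (rule genideal_ideal[OF assms(4)])
    have SU: "S \<subseteq> U"
      unfolding assms(5) by (rule genideal_self[OF assms(4)])
    have T: "?T \<subseteq> carrier A"
      using ideal.Icarr[OF U] by auto
    have W: "ideal W A"
      unfolding assms(6) by (rule genideal_ideal[OF T])
    have TW: "?T \<subseteq> W"
      unfolding assms(6) by (rule genideal_self[OF T])
    have I: "ideal (Idl\<^bsub>A\<^esub> F) A"
      by (rule genideal_ideal[OF F])
    have FI: "z \<in> F \<Longrightarrow> z \<in> Idl\<^bsub>A\<^esub> F" for z
      using genideal_self[OF F] by blast
    have "U \<subseteq> ideal.tame W A"
      by (rule ideal.subset_tame[OF W U]) (use TW in blast)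
    then have "S \<subseteq> ideal.tame W A"
      using SU by blast
    note S_tame = subsetD[OF this]
    have "F \<subseteq> W"
      by (rule F_least)
        (simp_all add: X ideal.tameD[OF W S_tame] ideal.tame_mult[OF W S_tame])
    then have le: "Idl\<^bsub>A\<^esub> F \<subseteq> W"
      by (rule genideal_minimal[OF W])
    let ?Y = "X \<union> {r \<odot>\<^bsub>A\<^esub> \<one> | r. r \<in> carrier R}"
    have gen: "carrier A = generate_ring A ?Y"
      by (rule generate_ring_scalars[OF assms(2,3)])
    have Y: "y \<in> ?Y \<Longrightarrow> y \<in> carrier A" for y
      using X by auto
    have central: "commutator A y a = \<zero>" "commutator A a y = \<zero>"
      if "y \<in> ?Y" "y \<notin> X" "a \<in> carrier A" for y a
      using that scalar_central by auto
    have zero: "\<zero> \<in> Idl\<^bsub>A\<^esub> F"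
      by (rule additive_subgroup.zero_closed[OF ideal.axioms(1)[OF I]])
    \<comment> \<open>For generators in \<open>X\<close> the conditions of \<open>mem_tame\<close> are the generators of the ideal; as soon as
      one of the entries is a scalar, the expression vanishes.\<close>
    note mem = F_mem[THEN FI, unfolded commutator3_def skew_defect_def]
    note vanish = commutator3_def skew_defect_def central bracket_trivial zero
    have "s \<in> ideal.tame (Idl\<^bsub>A\<^esub> F) A" if s: "s \<in> S" for s
    proof (rule ideal.mem_tame[OF I gen S[OF s]])
      fix x y assume xy: "x \<in> ?Y" "y \<in> ?Y"
      show "commutator3 A s x y \<in> Idl\<^bsub>A\<^esub> F"
        by (cases "x \<in> X"; cases "y \<in> X")
          (use s xy in \<open>simp_all add: mem vanish S Y del: Un_iff\<close>)
      fix z assume z: "z \<in> ?Y"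
      show "s \<otimes> commutator3 A x y z \<in> Idl\<^bsub>A\<^esub> F"
        by (cases "x \<in> X"; cases "y \<in> X"; cases "z \<in> X")
          (use s xy z in \<open>simp_all add: mem vanish S Y del: Un_iff\<close>)
      show "skew_defect A s x y z \<in> Idl\<^bsub>A\<^esub> F"
        by (cases "x \<in> X"; cases "y \<in> X"; cases "z \<in> X")
          (use s xy z in \<open>simp_all add: mem vanish S Y del: Un_iff\<close>)
      fix w assume w: "w \<in> ?Y"
      show "commutator A s x \<otimes> commutator3 A y z w \<in> Idl\<^bsub>A\<^esub> F"
        by (cases "x \<in> X"; cases "y \<in> X"; cases "z \<in> X"; cases "w \<in> X")
          (use s xy z w in \<open>simp_all add: mem vanish S Y del: Un_iff\<close>)
      show "s \<otimes> skew_defect A x y z w \<in> Idl\<^bsub>A\<^esub> F"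
        by (cases "x \<in> X"; cases "y \<in> X"; cases "z \<in> X"; cases "w \<in> X")
          (use s xy z w in \<open>simp_all add: mem vanish S Y del: Un_iff\<close>)
    qed
    then have "U \<subseteq> ideal.tame (Idl\<^bsub>A\<^esub> F) A"
      unfolding assms(5) by (intro genideal_minimal[OF ideal.ideal_tame[OF I]]) blast
    then have "?T \<subseteq> Idl\<^bsub>A\<^esub> F"
      using ideal.tameD(2)[OF I] by blast
    then have "W \<subseteq> Idl\<^bsub>A\<^esub> F"
      unfolding assms(6) by (rule genideal_minimal[OF I])
    with le show ?thesis
      unfolding F_def by blast
  qed
qed

end
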